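(* Let $\Delta\subset\mathbb{R}^n_q$ be a smooth convex body, and adopt the convention that the periodic billiard trajectories in $\Delta$ include the projections to $\Delta$ of periodic gliding billiard trajectories in $\Delta\times B^n$. Then there exists a periodic billiard trajectory $\sigma$ in $\Delta$ with $$L(\sigma)\le \pi\,{\rm diam}(\Delta).$$
   Context: A convex body in $\mathbb{R}^n$ is a compact convex subset with nonempty interior; it is smooth if its boundary is smooth. $B^n$ here denotes the (closed) unit ball of $\mathbb{R}^n_p$. Periodic billiard trajectory (without gliding): a nonconstant, continuous, piecewise $C^\infty$ path $\sigma:[0,T]\to\Delta$ with $\sigma(T)=\sigma(0)$ for which there is a finite nonempty set $\mathscr{B}_\sigma\subset(0,T)$ with $\ddot\sigma\equiv0$ on $(0,T)\setminus\mathscr{B}_\sigma$, $\sigma(t)\in\partial\Delta$ for $t\in\mathscr{B}_\sigma$, and for each $t\in\mathscr{B}_\sigma$ the one-sided limits satisfy $\dot\sigma^+(t)+\dot\sigma^-(t)\in T_{\sigma(t)}\partial\Delta$ and $\dot\sigma^+(t)-\dot\sigma^-(t)\in(T_{\sigma(t)}\partial\Delta)^\perp\setminus\{0\}$; moreover, with $\dot\sigma^+(0)=\lim_{t\to0+}\dot\sigma(t)$ and $\dot\sigma^-(T)=\lim_{t\to T-}\dot\sigma(t)$: if $\sigma(0)\in{\rm int}\,\Delta$ then $\dot\sigma^+(0)=\dot\sigma^-(T)$; if $\sigma(0)=\sigma(T)\in\partial\Delta$, then at least one of $\dot\sigma^+(0)=\dot\sigma^-(T)$, $\dot\sigma^-(0)=\dot\sigma^-(T)$,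 $\dot\sigma^+(0)=\dot\sigma^+(T)$, $\dot\sigma^-(0)=\dot\sigma^+(T)$ holds, where $\dot\sigma^-(0)$ (resp. $\dot\sigma^+(T)$) is the unique vector such that $\dot\sigma^+(s)+\dot\sigma^-(s)\in T_{\sigma(s)}\partial\Delta$ and $\dot\sigma^+(s)-\dot\sigma^-(s)\in(T_{\sigma(s)}\partial\Delta)^\perp$ for $s=0$ (resp. $s=T$). Its length $L(\sigma)$ is the sum of the lengths of its straight segments. Periodic gliding billiard trajectory in $\Delta\times B^n$: for a convex body $C$ with $0\in{\rm Int}(C)$ let $j_C(z)=\inf\{\lambda>0 : z/\lambda\in C\}$. When $0\in{\rm Int}(\Delta)$ and $\Lambda=B^n$, put $\mathfrak{X}(q,p)=(-\nabla j_\Lambda(p),0)$ on ${\rm Int}(\Delta)\times\partial\Lambda$ and $\mathfrak{X}(q,p)=(0,\nabla j_\Delta(q))$ on $\partial\Delta\times{\rm Int}(\Lambda)$. A periodic $(\Delta,\Lambda)$-billiard trajectory is a continuous piecewise smooth map $\gamma=(\gamma_q,\gamma_p):[0,T]\to\partial(\Delta\times\Lambda)$ with $\gamma(T)=\gamma(0)$ such that (BT1) for some constant $\kappa>0$, $\dot\gamma(t)=\kappa\mathfrak{X}(\gamma(t))$ on $[0,T]\setminus\gamma^{-1}(\partial\Delta\times\partial\Lambda)$; (BT2) $\gamma$ has a right derivative at every $t\in\gamma^{-1}(\partial\Delta\times\partial\Lambda)\setminus\{T\}$ and a left derivative at every $t\in\gamma^{-1}(\partial\Delta\times\partial\Lambda)\setminus\{0\}$,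 and these belong to $\{-\lambda(\nabla j_\Lambda(\gamma_p(t)),0)+\mu(0,\nabla j_\Delta(\gamma_q(t))) : \lambda\ge0,\mu\ge0,(\lambda,\mu)\ne(0,0)\}$. For general $\Delta$ (not necessarily containing $0$ in its interior) and $\Lambda=B^n$, a continuous piecewise smooth map $\gamma=(\gamma_q,\gamma_p):[0,T]\to\partial(\Delta\times\Lambda)$ with $\gamma(T)=\gamma(0)$ is a periodic $(\Delta,\Lambda)$-billiard trajectory if for some $\bar q\in{\rm Int}(\Delta)$ and $\bar p\in{\rm Int}(\Lambda)$, writing $\Delta'=\Delta-\bar q$, $\Lambda'=\Lambda-\bar p$ (smooth convex bodies containing $0$ in their interiors), the translated map $\eta=(\eta_q,\eta_p)=\gamma-(\bar q,\bar p):[0,T]\to\partial(\Delta'\times\Lambda')$ has the following two properties: there is a constant $\kappa>0$ such that, for all $t\in[0,T]\setminus\eta^{-1}(\partial\Delta'\times\partial\Lambda')$, $\dot\eta(t)=\kappa(-\nabla j_{\Lambda'}(\eta_p(t)),0)$ if $\eta(t)\in{\rm Int}(\Delta')\times\partial\Lambda'$ and $\dot\eta(t)=\kappa(0,\nabla j_{\Delta'}(\eta_q(t)))$ if $\eta(t)\in\partial\Delta'\times{\rm Int}(\Lambda')$; and $\eta$ has a right derivative at every $t\in\eta^{-1}(\partial\Delta'\times\partial\Lambda')\setminus\{T\}$ and a left derivative at every $t\in\eta^{-1}(\partial\Delta'\times\partial\Lambda')\setminus\{0\}$, all of which belong to $\{-\lambda(\nabla j_{\Lambda'}(\eta_p(t)),0)+\mu(0,\nabla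 j_{\Delta'}(\eta_q(t))) : \lambda\ge0,\mu\ge0,(\lambda,\mu)\ne(0,0)\}$. A periodic $(\Delta,\Lambda)$-billiard trajectory $\gamma$ is gliding if $\gamma([0,T])\subset\partial\Delta\times\partial\Lambda$. Its projection to $\Delta$ is the closed curve $\sigma=\gamma_q$, with $L(\sigma)$ its Euclidean length. *)

theory Defs
  imports "HOL-Analysis.Analysis"
begin

subsection \<open>Smoothness\<close>

text \<open>
  Derivatives are taken within \<open>A\<close>, so that on a nondegenerate interval \<open>{a..b}\<close> they are one-sided
  at the end points. The successive derivatives of \<open>f\<close> are accessed through directional derivatives.
\<close>

primrec Ck_on ::
  "nat \<Rightarrow> 'a::real_normed_vector set \<Rightarrow> ('a \<Rightarrow> 'b::real_normed_vector) \<Rightarrow> bool" where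
  "Ck_on 0 A f \<longleftrightarrow> continuous_on A f"
| "Ck_on (Suc k) A f \<longleftrightarrow>
     (\<exists>f'. (\<forall>x\<in>A. (f has_derivative f' x) (at x within A)) \<and> (\<forall>h. Ck_on k A (\<lambda>x. f' x h)))"

definition smooth_on :: "'a::real_normed_vector set \<Rightarrow> ('a \<Rightarrow> 'b::real_normed_vector) \<Rightarrow> bool" where
  "smooth_on A f \<longleftrightarrow> (\<forall>k. Ck_on k A f)"

text \<open>\<open>f\<close> is smooth up to the end points on each closed interval between consecutive break points.\<close>

definition piecewise_smooth_on :: "real \<Rightarrow> real \<Rightarrow> (real \<Rightarrow> 'a::real_normed_vector) \<Rightarrow> bool" where
  "piecewise_smooth_on a b f \<longleftrightarrow>
     continuous_on {a..b} f \<and>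
     (\<exists>S. finite S \<and>
       (\<forall>c d. a \<le> c \<and> c < d \<and> d \<le> b \<and> {c<..<d} \<inter> S = {} \<longrightarrow> smooth_on {c..d} f))"

definition smooth_hypersurface :: "'a::euclidean_space set \<Rightarrow> bool" where
  "smooth_hypersurface M \<longleftrightarrow>
     (\<forall>x\<in>M. \<exists>U (f :: 'a \<Rightarrow> real) g. open U \<and> x \<in> U \<and> smooth_on U f \<and>
        (\<forall>y\<in>U. GDERIV f y :> g y \<and> g y \<noteq> 0) \<and> M \<inter> U = {y \<in> U. f y = 0})"

text \<open>Velocities at \<open>x\<close> of smooth curves in \<open>M\<close>; a linear subspace if \<open>M\<close> is a smooth hypersurface.\<close>

definition tangent_space :: "'a::euclidean_space set \<Rightarrow> 'a \<Rightarrow> 'a set" where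
  "tangent_space M x =
     {v. \<exists>\<epsilon>>0. \<exists>c. smooth_on {-\<epsilon><..<\<epsilon>} c \<and> c ` {-\<epsilon><..<\<epsilon>} \<subseteq> M \<and> c 0 = x \<and>
           (c has_vector_derivative v) (at 0)}"

definition convex_body :: "'a::euclidean_space set \<Rightarrow> bool" where
  "convex_body C \<longleftrightarrow> compact C \<and> convex C \<and> interior C \<noteq> {}"

definition smooth_convex_body :: "'a::euclidean_space set \<Rightarrow> bool" where
  "smooth_convex_body C \<longleftrightarrow> convex_body C \<and> smooth_hypersurface (frontier C)"


subsection \<open>Billiard trajectories without gliding\<close>

abbreviation right_velocity :: "(real \<Rightarrow> 'a::real_normed_vector) \<Rightarrow> real \<Rightarrow> 'a \<Rightarrow> bool" where
  "right_velocity \<sigma> t v \<equiv> ((\<lambda>s. vector_derivative \<sigma> (at s)) \<longlongrightarrow> v) (at_right t)"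

abbreviation left_velocity :: "(real \<Rightarrow> 'a::real_normed_vector) \<Rightarrow> real \<Rightarrow> 'a \<Rightarrow> bool" where
  "left_velocity \<sigma> t v \<equiv> ((\<lambda>s. vector_derivative \<sigma> (at s)) \<longlongrightarrow> v) (at_left t)"

text \<open>\<open>v\<^sup>+\<close> and \<open>v\<^sup>-\<close> are mirror images with respect to the linear subspace \<open>V\<close>.\<close>

definition reflects :: "'a::euclidean_space set \<Rightarrow> 'a \<Rightarrow> 'a \<Rightarrow> bool" where
  "reflects V vp vm \<longleftrightarrow> vp + vm \<in> V \<and> vp - vm \<in> orthogonal_comp V"

lemma reflects_unique:
  assumes "reflects V v w" "reflects V v w'"
  shows "w = w'"
proof -
  have o: "inner x (v - w) = 0" "inner x (v - w') = 0" if "x \<in> V" for x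
    using assms that by (auto simp: reflects_def orthogonal_comp_def orthogonal_def)
  have "inner (v + w) (v - w) = 0" "inner (v + w) (v - w') = 0"
    "inner (v + w') (v - w) = 0" "inner (v + w') (v - w') = 0"
    using o assms by (auto simp: reflects_def)
  then have "inner (w - w') (w - w') = 0"
    by (simp add: inner_simps inner_commute)
  then show ?thesis by simp
qed

lemma reflects_sym: "reflects V v w \<longleftrightarrow> reflects V w v"
proof -
  have "reflects V a b" if "reflects V b a" for a b
    using that by (auto simp: reflects_def orthogonal_comp_def orthogonal_def inner_simps add.commute)
  then show ?thesis by blast
qed

text \<open>
  The set \<open>B\<close> of bounce times is determined by \<open>\<sigma>\<close>: it is the set of jumps of the velocity.
  In the last conjunct, \<open>v0p\<close> and \<open>vTm\<close> are the one-sided velocities at the times \<open>0\<close> and \<open>T\<close>, and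
  \<open>v0m\<close> and \<open>vTp\<close> are their (unique) mirror images.
\<close>

definition nongliding_billiard_trajectory ::
  "'a::euclidean_space set \<Rightarrow> real \<Rightarrow> (real \<Rightarrow> 'a) \<Rightarrow> real set \<Rightarrow> bool" where
  "nongliding_billiard_trajectory \<Delta> T \<sigma> B \<longleftrightarrow>
     \<not> \<sigma> constant_on {0..T} \<and> piecewise_smooth_on 0 T \<sigma> \<and> \<sigma> ` {0..T} \<subseteq> \<Delta> \<and> \<sigma> T = \<sigma> 0 \<and>
     finite B \<and> B \<noteq> {} \<and> B \<subseteq> {0<..<T} \<and>
     (\<exists>v. \<forall>t\<in>{0<..<T} - B.
        (\<sigma> has_vector_derivative v t) (at t) \<and> (v has_vector_derivative 0) (at t)) \<and>
     (\<forall>t\<in>B. \<sigma> t \<in> frontier \<Delta> \<and>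
        (\<exists>vp vm. right_velocity \<sigma> t vp \<and> left_velocity \<sigma> t vm \<and>
           reflects (tangent_space (frontier \<Delta>) (\<sigma> t)) vp vm \<and> vp - vm \<noteq> 0)) \<and>
     (\<exists>v0p vTm. right_velocity \<sigma> 0 v0p \<and> left_velocity \<sigma> T vTm \<and>
        (\<sigma> 0 \<in> interior \<Delta> \<longrightarrow> v0p = vTm) \<and>
        (\<sigma> 0 \<in> frontier \<Delta> \<longrightarrow>
           (\<exists>v0m vTp. reflects (tangent_space (frontier \<Delta>) (\<sigma> 0)) v0p v0m \<and>
              reflects (tangent_space (frontier \<Delta>) (\<sigma> T)) vTp vTm \<and>
              (v0p = vTm \<or> v0m = vTm \<or> v0p = vTp \<or> v0m = vTp))))"


subsection \<open>Gliding billiard trajectories\<close>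

definition minkowski_functional :: "'a::real_vector set \<Rightarrow> 'a \<Rightarrow> real" where
  "minkowski_functional C z = Inf {l. 0 < l \<and> (1 / l) *\<^sub>R z \<in> C}"

definition gradient :: "('a::real_inner \<Rightarrow> real) \<Rightarrow> 'a \<Rightarrow> 'a" where
  "gradient f x = (THE D. GDERIV f x :> D)"

text \<open>Here \<open>0\<close> is assumed to be an interior point of both bodies.\<close>

definition centred_billiard_trajectory ::
  "'a::euclidean_space set \<Rightarrow> 'a set \<Rightarrow> real \<Rightarrow> (real \<Rightarrow> 'a \<times> 'a) \<Rightarrow> bool" where
  "centred_billiard_trajectory \<Delta> \<Lambda> T \<gamma> \<longleftrightarrow>
     (let nq = (\<lambda>t. gradient (minkowski_functional \<Delta>) (fst (\<gamma> t)));
          np = (\<lambda>t. gradient (minkowski_functional \<Lambda>) (snd (\<gamma> t)));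
          cone = (\<lambda>t. {(- l *\<^sub>R np t, m *\<^sub>R nq t) | l m.
                         (0::real) \<le> l \<and> (0::real) \<le> m \<and> (l, m) \<noteq> (0, 0)})
      in 0 < T \<and> piecewise_smooth_on 0 T \<gamma> \<and> \<gamma> ` {0..T} \<subseteq> frontier (\<Delta> \<times> \<Lambda>) \<and> \<gamma> T = \<gamma> 0 \<and>
         (\<exists>\<kappa>>0. \<forall>t\<in>{0..T}.
            (\<gamma> t \<in> interior \<Delta> \<times> frontier \<Lambda> \<longrightarrow>
               (\<gamma> has_vector_derivative \<kappa> *\<^sub>R (- np t, 0)) (at t within {0..T})) \<and>
            (\<gamma> t \<in> frontier \<Delta> \<times> interior \<Lambda> \<longrightarrow>
               (\<gamma> has_vector_derivative \<kappa> *\<^sub>R (0, nq t)) (at t within {0..T}))) \<and>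
         (\<forall>t\<in>{0..T}. \<gamma> t \<in> frontier \<Delta> \<times> frontier \<Lambda> \<longrightarrow>
            (t \<noteq> T \<longrightarrow> (\<exists>w\<in>cone t. (\<gamma> has_vector_derivative w) (at_right t))) \<and>
            (t \<noteq> 0 \<longrightarrow> (\<exists>w\<in>cone t. (\<gamma> has_vector_derivative w) (at_left t)))))"

definition product_billiard_trajectory ::
  "'a::euclidean_space set \<Rightarrow> 'a set \<Rightarrow> real \<Rightarrow> (real \<Rightarrow> 'a \<times> 'a) \<Rightarrow> bool" where
  "product_billiard_trajectory \<Delta> \<Lambda> T \<gamma> \<longleftrightarrow>
     (\<exists>q\<in>interior \<Delta>. \<exists>p\<in>interior \<Lambda>.
        centred_billiard_trajectory ((\<lambda>x. x - q) ` \<Delta>) ((\<lambda>y. y - p) ` \<Lambda>) T (\<lambda>t. \<gamma> t - (q, p)))"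

definition gliding_billiard_trajectory ::
  "'a::euclidean_space set \<Rightarrow> 'a set \<Rightarrow> real \<Rightarrow> (real \<Rightarrow> 'a \<times> 'a) \<Rightarrow> bool" where
  "gliding_billiard_trajectory \<Delta> \<Lambda> T \<gamma> \<longleftrightarrow>
     product_billiard_trajectory \<Delta> \<Lambda> T \<gamma> \<and> \<gamma> ` {0..T} \<subseteq> frontier \<Delta> \<times> frontier \<Lambda>"


subsection \<open>Periodic billiard trajectories and their length\<close>

definition periodic_billiard_trajectory ::
  "'a::euclidean_space set \<Rightarrow> real \<Rightarrow> (real \<Rightarrow> 'a) \<Rightarrow> bool" where
  "periodic_billiard_trajectory \<Delta> T \<sigma> \<longleftrightarrow>
     (\<exists>B. nongliding_billiard_trajectory \<Delta> T \<sigma> B) \<or>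
     (\<exists>\<gamma>. gliding_billiard_trajectory \<Delta> (cball 0 1) T \<gamma> \<and> (\<forall>t\<in>{0..T}. \<sigma> t = fst (\<gamma> t)))"

definition curve_length :: "real \<Rightarrow> real \<Rightarrow> (real \<Rightarrow> 'a::euclidean_space) \<Rightarrow> real" where
  "curve_length a b \<sigma> = integral {a..b} (\<lambda>t. norm (vector_derivative \<sigma> (at t)))"

lemma has_integral_sorted:
  fixes g :: "real \<Rightarrow> real"
  assumes "sorted ts" "ts \<noteq> []"
    and "\<And>i. Suc i < length ts \<Longrightarrow> (g has_integral d (ts ! i) (ts ! Suc i)) {ts ! i..ts ! Suc i}"
  shows "(g has_integral (\<Sum>i<length ts - 1. d (ts ! i) (ts ! Suc i))) {hd ts..last ts}"
  using assms
proof (induction ts rule: induct_list012)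
  case 1
  then show ?case by simp
next
  case (2 x)
  then show ?case by (simp add: has_integral_refl)
next
  case (3 x y zs)
  have tl: "(g has_integral (\<Sum>i<length (y # zs) - 1. d ((y # zs) ! i) ((y # zs) ! Suc i)))
      {hd (y # zs)..last (y # zs)}"
  proof (rule "3.IH"(2))
    show "sorted (y # zs)" "y # zs \<noteq> []" using "3.prems" by auto
    show "(g has_integral d ((y # zs) ! i) ((y # zs) ! Suc i)) {(y # zs) ! i..(y # zs) ! Suc i}"
      if "Suc i < length (y # zs)" for i
      using "3.prems"(3)[of "Suc i"] that by simp
  qed
  have hd: "(g has_integral d x y) {x..y}" using "3.prems"(3)[of 0] by simp
  have le: "x \<le> y" "y \<le> last (y # zs)"
    using "3.prems"(1) by (auto simp: last_in_set)
  have "(g has_integral (d x y + (\<Sum>i<length (y # zs) - 1. d ((y # zs) ! i) ((y # zs) ! Suc i))))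
      {x..last (y # zs)}"
    using has_integral_combine[OF le hd] tl by simp
  moreover have "(\<Sum>i<length (x # y # zs) - 1. d ((x # y # zs) ! i) ((x # y # zs) ! Suc i)) =
      d x y + (\<Sum>i<length (y # zs) - 1. d ((y # zs) ! i) ((y # zs) ! Suc i))"
    by (simp add: sum.lessThan_Suc_shift del: sum.lessThan_Suc)
  ultimately show ?case by simp
qed

text \<open>The length of a trajectory without gliding is the sum of the lengths of its straight segments.\<close>

lemma curve_length_nongliding:
  assumes "nongliding_billiard_trajectory \<Delta> T \<sigma> B"
  defines "ts \<equiv> sorted_list_of_set ({0, T} \<union> B)"
  shows "curve_length 0 T \<sigma> = (\<Sum>i<length ts - 1. dist (\<sigma> (ts ! i)) (\<sigma> (ts ! Suc i)))"
proof -
  from assms(1) have fin: "finite B" and ne: "B \<noteq> {}" and sub: "B \<subseteq> {0<..<T}"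
    and cont: "continuous_on {0..T} \<sigma>"
    by (auto simp: nongliding_billiard_trajectory_def piecewise_smooth_on_def)
  from assms(1) obtain v where v: "\<And>t. t \<in> {0<..<T} - B \<Longrightarrow> (\<sigma> has_vector_derivative v t) (at t)"
    "\<And>t. t \<in> {0<..<T} - B \<Longrightarrow> (v has_vector_derivative 0) (at t)"
    unfolding nongliding_billiard_trajectory_def by blast
  have T: "0 < T" using ne sub by force
  have seg: "((\<lambda>t. norm (vector_derivative \<sigma> (at t))) has_integral dist (\<sigma> a) (\<sigma> b)) {a..b}"
    if ab: "0 \<le> a" "a < b" "b \<le> T" "{a<..<b} \<inter> B = {}" for a b
  proof -
    have in_dom: "t \<in> {0<..<T} - B" if "t \<in> {a<..<b}" for t using ab that by auto
    obtain c where c: "\<And>t. t \<in> {a<..<b} \<Longrightarrow> v t = c"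
    proof -
      have "\<exists>c. \<forall>t\<in>{a<..<b}. v t = c"
      proof (rule has_vector_derivative_zero_constant[of "{a<..<b}" v])
        show "(v has_vector_derivative 0) (at t within {a<..<b})" if "t \<in> {a<..<b}" for t
          using v(2)[OF in_dom[OF that]] has_vector_derivative_at_within by blast
      qed auto
      then show ?thesis using that by blast
    qed
    have "((\<lambda>_. c) has_integral (\<sigma> b - \<sigma> a)) {a..b}"
    proof (rule fundamental_theorem_of_calculus_interior)
      show "continuous_on {a..b} \<sigma>" using cont ab by (auto intro: continuous_on_subset)
      show "(\<sigma> has_vector_derivative c) (at t)" if "t \<in> {a<..<b}" for t
        using v(1)[OF in_dom[OF that]] c[OF that] by simp
    qed (use ab in auto)
    moreover have "((\<lambda>_. c) has_integral (b - a) *\<^sub>R c) {a..b}"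
      using has_integral_const_real[of c a b] ab by simp
    ultimately have "\<sigma> b - \<sigma> a = (b - a) *\<^sub>R c" by (rule has_integral_unique)
    then have d: "dist (\<sigma> a) (\<sigma> b) = (b - a) * norm c"
      using ab by (metis abs_of_pos diff_gt_0_iff_gt dist_commute dist_norm norm_scaleR)
    have "((\<lambda>_. norm c) has_integral dist (\<sigma> a) (\<sigma> b)) {a..b}"
      using has_integral_const_real[of "norm c" a b] ab d by simp
    then show ?thesis
    proof (rule has_integral_spike_finite[of "{a, b}", rotated 2])
      show "norm (vector_derivative \<sigma> (at t)) = norm c" if "t \<in> {a..b} - {a, b}" for t
        using that v(1)[OF in_dom, of t] c[of t] by (auto simp: vector_derivative_at)
    qed simp
  qed
  have set: "set ts = {0, T} \<union> B"
    unfolding ts_def using fin by (intro set_sorted_list_of_set) auto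
  have srt: "sorted ts" unfolding ts_def by (rule sorted_sorted_list_of_set)
  have dst: "sorted_wrt (<) ts" unfolding ts_def by (rule strict_sorted_list_of_set)
  have nonempty: "ts \<noteq> []" using set by auto
  have ends: "hd ts = 0" "last ts = T"
  proof -
    have bd: "0 \<le> t" "t \<le> T" if "t \<in> set ts" for t using that set sub T by auto
    obtain i where i: "i < length ts" "ts ! i = 0"
      using set by (metis UnI1 in_set_conv_nth insertI1)
    obtain j where j: "j < length ts" "ts ! j = T"
      using set by (metis UnI1 in_set_conv_nth insertI1 insertI2)
    have "ts ! 0 \<le> 0" using sorted_nth_mono[OF srt, of 0 i] i by simp
    then show "hd ts = 0"
      using bd(1)[of "hd ts"] nonempty by (simp add: hd_conv_nth)
    have "T \<le> ts ! (length ts - 1)" using sorted_nth_mono[OF srt, of j "length ts - 1"] j by simp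
    then show "last ts = T"
      using bd(2)[of "last ts"] nonempty by (simp add: last_conv_nth)
  qed
  have "((\<lambda>t. norm (vector_derivative \<sigma> (at t))) has_integral
      (\<Sum>i<length ts - 1. dist (\<sigma> (ts ! i)) (\<sigma> (ts ! Suc i)))) {hd ts..last ts}"
  proof (rule has_integral_sorted[OF srt nonempty])
    fix i assume i: "Suc i < length ts"
    have m: "ts ! i \<in> {0, T} \<union> B" "ts ! Suc i \<in> {0, T} \<union> B" using i set nth_mem[of _ ts] by auto
    show "((\<lambda>t. norm (vector_derivative \<sigma> (at t))) has_integral
        dist (\<sigma> (ts ! i)) (\<sigma> (ts ! Suc i))) {ts ! i..ts ! Suc i}"
    proof (rule seg)
      show "0 \<le> ts ! i" "ts ! Suc i \<le> T" using m sub T by auto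
      show "ts ! i < ts ! Suc i" using sorted_wrt_nth_less[OF dst, of i "Suc i"] i by simp
      show "{ts ! i<..<ts ! Suc i} \<inter> B = {}"
      proof -
        have False if "t \<in> B" "ts ! i < t" "t < ts ! Suc i" for t
        proof -
          obtain j where j: "j < length ts" "ts ! j = t"
            using set \<open>t \<in> B\<close> by (metis UnI2 in_set_conv_nth)
          have "i < j" using that j sorted_nth_mono[OF srt, of j i] i by force
          then have "ts ! Suc i \<le> ts ! j" using sorted_nth_mono[OF srt, of "Suc i" j] j by simp
          then show False using that j by simp
        qed
        then show ?thesis by auto
      qed
    qed
  qed
  then show ?thesis
    unfolding curve_length_def using ends by (simp add: integral_unique)
qed

end

theory Submission
  imports Defs
begin

text \<open>
  A chord \<open>[x, y]\<close> realising the diameter is a double normal: \<open>y\<close> maximises the distance to \<open>x\<close>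
  over the body, hence \<open>y - x\<close> is normal to the boundary at \<open>y\<close>, and symmetrically at \<open>x\<close>. Running
  back and forth along it is a billiard trajectory with two bounces, of length
  \<open>2 diam \<Delta> \<le> \<pi> diam \<Delta>\<close>.
\<close>

section \<open>Smoothness of constant and affine curves\<close>

lemma Ck_on_const: "Ck_on k A (\<lambda>_. c)"
proof (induction k arbitrary: c)
  case (Suc k)
  have "((\<lambda>_. c) has_derivative (\<lambda>_. 0)) (at x within A)" for x by simp
  then show ?case using Suc by (auto intro!: exI[of _ "\<lambda>_ _. 0"])
qed simp

lemma smooth_on_const: "smooth_on A (\<lambda>_. c)"
  by (simp add: smooth_on_def Ck_on_const)

text \<open>For each direction \<open>h\<close> the derivative is the constant
  \<open>h *\<^sub>R w\<close>, so all higher orders reduce to \<open>Ck_on_const\<close>. Agreement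
  is asked only on \<open>A\<close>, so that a path with a corner can be treated one leg at a
  time.\<close>

lemma smooth_on_affine:
  fixes f :: "real \<Rightarrow> 'a::real_normed_vector"
  assumes "\<And>t. t \<in> A \<Longrightarrow> f t = a + t *\<^sub>R w"
  shows "smooth_on A f"
proof -
  have der: "(f has_derivative (\<lambda>h. h *\<^sub>R w)) (at t within A)" if "t \<in> A" for t
  proof (rule has_derivative_transform[OF that])
    show "((\<lambda>t. a + t *\<^sub>R w) has_derivative (\<lambda>h. h *\<^sub>R w)) (at t within A)"
      by (auto intro!: derivative_eq_intros)
  qed (rule assms)
  have "continuous_on A f"
    using der has_derivative_continuous continuous_on_eq_continuous_within by blast
  moreover have "Ck_on (Suc k) A f" for k
    using der Ck_on_const by (auto intro!: exI[of _ "\<lambda>_ h. h *\<^sub>R w"])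
  ultimately have "Ck_on k A f" for k by (cases k) auto
  then show ?thesis by (simp add: smooth_on_def)
qed

section \<open>Farthest points: normality and position on the boundary\<close>

lemma zero_in_tangent_space:
  assumes "x \<in> M"
  shows "0 \<in> tangent_space M x"
  unfolding tangent_space_def mem_Collect_eq
  by (rule exI[of _ "1::real"], rule conjI[OF zero_less_one], rule exI[of _ "\<lambda>_. x"])
    (use assms smooth_on_const in auto)

text \<open>Along any curve in \<open>M\<close> through \<open>y\<close>, the squared distance to
  \<open>x\<close> has a local maximum at parameter 0, so its derivative there, twice the inner
  product of \<open>y - x\<close> with the velocity, vanishes.\<close>

lemma farthest_point_normal:
  assumes far: "\<And>z. z \<in> M \<Longrightarrow> dist x z \<le> dist x y"
  shows "y - x \<in> orthogonal_comp (tangent_space M y)"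
proof -
  have "(y - x) \<bullet> v = 0" if "v \<in> tangent_space M y" for v
  proof -
    from that obtain e c where e: "e > 0" and sub: "c ` {-e<..<e} \<subseteq> M" and c0: "c 0 = y"
      and c: "(c has_vector_derivative v) (at 0)"
      unfolding tangent_space_def by blast
    define g where "g s = (c s - x) \<bullet> (c s - x)" for s
    have "(g has_real_derivative 2 * ((y - x) \<bullet> v)) (at 0)"
      unfolding g_def has_field_derivative_def using c
      by (auto simp: has_vector_derivative_def c0 inner_commute algebra_simps fun_eq_iff
          intro!: derivative_eq_intros)
    moreover have "\<forall>s. \<bar>0 - s\<bar> < e \<longrightarrow> g s \<le> g 0"
    proof (intro allI impI)
      fix s assume "\<bar>0 - s\<bar> < e"
      then have "c s \<in> M" using sub by (auto intro!: subsetD[OF sub] imageI)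
      then have "dist x (c s) \<le> dist x y" by (rule far)
      then show "g s \<le> g 0"
        by (simp add: g_def c0 dist_norm norm_minus_commute[of x] norm_le)
    qed
    ultimately have "2 * ((y - x) \<bullet> v) = 0"
      by (rule DERIV_local_max[OF _ e])
    then show ?thesis by simp
  qed
  then show ?thesis by (auto simp: orthogonal_comp_def orthogonal_def inner_commute)
qed

text \<open>An interior point could be pushed a little further along the ray from \<open>x\<close>
  without leaving \<open>C\<close>, increasing the distance.\<close>

lemma farthest_point_in_frontier:
  fixes C :: "'a::euclidean_space set"
  assumes "y \<in> C" "x \<noteq> y" and far: "\<And>z. z \<in> C \<Longrightarrow> dist x z \<le> dist x y"
  shows "y \<in> frontier C"
proof -
  have "y \<notin> interior C"
  proof
    assume "y \<in> interior C"
    then obtain e where e: "e > 0" "cball y e \<subseteq> C" by (auto simp: mem_interior_cball)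
    \<comment> \<open>This scale makes the displacement \<open>r *\<^sub>R (y - x)\<close> have norm
      exactly \<open>e\<close>.\<close>
    define r where "r = e / norm (y - x)"
    have r: "r > 0" using e assms by (simp add: r_def)
    have "y + r *\<^sub>R (y - x) \<in> cball y e" using e assms by (simp add: r_def dist_norm)
    then have "dist x (y + r *\<^sub>R (y - x)) \<le> dist x y" using e far by blast
    moreover have "x - (y + r *\<^sub>R (y - x)) = (1 + r) *\<^sub>R (x - y)" by (simp add: algebra_simps)
    ultimately have "(1 + r) * norm (x - y) \<le> norm (x - y)" using r by (simp add: dist_norm)
    then show False using r assms by simp
  qed
  then show ?thesis using assms closure_subset by (auto simp: frontier_def)
qed

lemma convex_body_diametral_pair:
  fixes C :: "'a::euclidean_space set"
  assumes "convex_body C"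
  obtains x y where "x \<in> C" "y \<in> C" "x \<noteq> y" "dist x y = diameter C"
    "\<And>u v. u \<in> C \<Longrightarrow> v \<in> C \<Longrightarrow> dist u v \<le> dist x y"
proof -
  have C: "compact C" "interior C \<noteq> {}" using assms by (auto simp: convex_body_def)
  then have "C \<noteq> {}" using interior_subset by blast
  then obtain x y where xy: "x \<in> C" "y \<in> C" "dist x y = diameter C"
    using diameter_compact_attained C by blast
  have le: "dist u v \<le> dist x y" if "u \<in> C" "v \<in> C" for u v
    using that xy diameter_bounded_bound compact_imp_bounded C by metis
  have "x \<noteq> y"
  proof
    assume "x = y"
    \<comment> \<open>With maximal distance 0 the body collapses to a point, and its nonempty
      interior would be an open singleton.\<close>
    then have "C \<subseteq> {x}" using le xy by fastforce
    then have "interior C = {x}" using C interior_subset by blast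
    then show False using open_interior[of C] not_open_singleton by metis
  qed
  then show ?thesis using that xy le by blast
qed

section \<open>The path back and forth along a chord\<close>

text \<open>The coefficient is a tent function, rising from 0 to 1 on \<open>{0..1}\<close> and
  falling back on \<open>{1..2}\<close>: the path goes from \<open>x\<close> to \<open>y\<close> and
  returns, one unit of time per leg, with its only corner at time 1.\<close>

definition shuttle :: "'a::real_vector \<Rightarrow> 'a \<Rightarrow> real \<Rightarrow> 'a" where
  "shuttle x y t = x + (1 - \<bar>t - 1\<bar>) *\<^sub>R (y - x)"

lemma shuttle_derivative:
  "t < 1 \<Longrightarrow> (shuttle x y has_vector_derivative y - x) (at t)"
  "t > 1 \<Longrightarrow> (shuttle x y has_vector_derivative x - y) (at t)"
proof -
  assume "t < 1"
  have "((\<lambda>t. x + t *\<^sub>R (y - x)) has_vector_derivative y - x) (at t)"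
    by (auto intro!: derivative_eq_intros)
  then show "(shuttle x y has_vector_derivative y - x) (at t)"
    by (rule has_vector_derivative_transform_within_open[of _ _ _ "{..<1}"])
      (use \<open>t < 1\<close> in \<open>auto simp: shuttle_def\<close>)
next
  assume "t > 1"
  have "((\<lambda>t. x + (2 - t) *\<^sub>R (y - x)) has_vector_derivative x - y) (at t)"
    by (auto intro!: derivative_eq_intros simp: algebra_simps)
  then show "(shuttle x y has_vector_derivative x - y) (at t)"
    by (rule has_vector_derivative_transform_within_open[of _ _ _ "{1<..}"])
      (use \<open>t > 1\<close> in \<open>auto simp: shuttle_def\<close>)
qed

lemma shuttle_velocity:
  "right_velocity (shuttle x y) 0 (y - x)" "left_velocity (shuttle x y) 1 (y - x)"
  "right_velocity (shuttle x y) 1 (x - y)" "left_velocity (shuttle x y) 2 (x - y)"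
proof -
  \<comment> \<open>The velocity is constant on each open leg, so the one-sided limits are those of
    eventually constant functions.\<close>
  have w: "vector_derivative (shuttle x y) (at s) = y - x" if "s \<in> {0<..<1}" for s
    using that by (intro vector_derivative_at shuttle_derivative) auto
  show "right_velocity (shuttle x y) 0 (y - x)" "left_velocity (shuttle x y) 1 (y - x)"
    using eventually_mono[OF eventually_at_right_real[of 0 1] w]
      eventually_mono[OF eventually_at_left_real[of 0 1] w]
    by (auto intro: tendsto_eventually)
  have w: "vector_derivative (shuttle x y) (at s) = x - y" if "s \<in> {1<..<2}" for s
    using that by (intro vector_derivative_at shuttle_derivative) auto
  show "right_velocity (shuttle x y) 1 (x - y)" "left_velocity (shuttle x y) 2 (x - y)"
    using eventually_mono[OF eventually_at_right_real[of 1 2] w]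
      eventually_mono[OF eventually_at_left_real[of 1 2] w]
    by (auto intro: tendsto_eventually)
qed

lemma piecewise_smooth_on_shuttle:
  fixes x y :: "'a::real_normed_vector"
  shows "piecewise_smooth_on 0 2 (shuttle x y)"
proof -
  have "continuous_on {0..2} (shuttle x y)"
    unfolding shuttle_def by (intro continuous_intros)
  moreover have "smooth_on {c..d} (shuttle x y)" if cd: "c < d" "{c<..<d} \<inter> {1} = {}" for c d :: real
  proof (cases "d \<le> 1")
    case True
    show ?thesis
      by (rule smooth_on_affine[of _ _ x "y - x"]) (use True in \<open>auto simp: shuttle_def\<close>)
  next
    case False
    then have "1 \<le> c" using cd by auto
    then show ?thesis
      \<comment> \<open>The returning leg \<open>x + (2 - t) *\<^sub>R (y - x)\<close>, rewritten as
        a base point plus \<open>t\<close> times a direction.\<close>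
      by (intro smooth_on_affine[of _ _ "x + 2 *\<^sub>R (y - x)" "x - y"])
        (auto simp: shuttle_def algebra_simps)
  qed
  ultimately show ?thesis
    unfolding piecewise_smooth_on_def by (auto intro!: exI[of _ "{1::real}"])
qed

lemma shuttle_in_convex:
  assumes "convex C" "x \<in> C" "y \<in> C" "t \<in> {0..2}"
  shows "shuttle x y t \<in> C"
proof -
  have "shuttle x y t = \<bar>t - 1\<bar> *\<^sub>R x + (1 - \<bar>t - 1\<bar>) *\<^sub>R y"
    by (simp add: shuttle_def algebra_simps)
  then show ?thesis using assms by (auto intro!: convexD)
qed

section \<open>Reflection at a double normal\<close>

text \<open>A normal velocity is reversed: the sum \<open>v + (- v)\<close> is 0, which is tangent
  by way of the constant curve, and the difference \<open>v + v\<close> is again normal.\<close>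

lemma reflects_minus:
  assumes "x \<in> M" "v \<in> orthogonal_comp (tangent_space M x)"
  shows "reflects (tangent_space M x) v (- v)"
proof -
  have "v + v \<in> orthogonal_comp (tangent_space M x)"
    using assms(2) by (auto simp: orthogonal_comp_def orthogonal_def inner_simps)
  then show ?thesis using assms(1) zero_in_tangent_space by (auto simp: reflects_def)
qed

text \<open>The bounce at \<open>y\<close> is the single element of the bounce set; the one at
  \<open>x\<close> falls on the seam between times 0 and 2 and is handled by the closing condition
  on the end velocities.\<close>

lemma shuttle_billiard_trajectory:
  fixes x y :: "'a::euclidean_space"
  assumes "convex C" and "x \<in> C" "y \<in> C" "x \<noteq> y"
    and far: "\<And>u v. u \<in> C \<Longrightarrow> v \<in> C \<Longrightarrow> dist u v \<le> dist x y"
    and "closed C"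
  shows "nongliding_billiard_trajectory C 2 (shuttle x y) {1}"
proof -
  let ?F = "frontier C"
  have fr: "frontier C \<subseteq> C" using \<open>closed C\<close> by (rule frontier_subset_closed)
  have xF: "x \<in> ?F"
    by (rule farthest_point_in_frontier[of _ _ y]) (use assms in \<open>auto simp: dist_commute\<close>)
  have yF: "y \<in> ?F"
    by (rule farthest_point_in_frontier[of _ _ x]) (use assms in auto)
  \<comment> \<open>Here \<open>x\<close> is the point farthest from \<open>y\<close>; below, the
    roles are exchanged.\<close>
  have "x - y \<in> orthogonal_comp (tangent_space ?F x)"
    by (rule farthest_point_normal) (metis assms(3) dist_commute far fr subsetD)
  then have rx: "reflects (tangent_space ?F x) (x - y) (y - x)"
    using reflects_minus[OF xF, of "x - y"] by simp
  have "y - x \<in> orthogonal_comp (tangent_space ?F y)"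
    by (rule farthest_point_normal) (metis assms(2) far fr subsetD)
  then have ry: "reflects (tangent_space ?F y) (y - x) (x - y)"
    using reflects_minus[OF yF, of "y - x"] by simp
  have ends: "shuttle x y 0 = x" "shuttle x y 1 = y" "shuttle x y 2 = x"
    by (auto simp: shuttle_def)
  have "\<not> shuttle x y constant_on {0..2}"
  proof
    assume "shuttle x y constant_on {0..2}"
    then obtain c where "\<And>t. t \<in> {0..2} \<Longrightarrow> shuttle x y t = c" unfolding constant_on_def by blast
    from this[of 0] this[of 1] show False using \<open>x \<noteq> y\<close> ends by simp
  qed
  moreover have "shuttle x y ` {0..2} \<subseteq> C" using shuttle_in_convex assms by blast
  moreover have "\<exists>v. \<forall>t\<in>{0<..<2} - {1}.
      (shuttle x y has_vector_derivative v t) (at t) \<and> (v has_vector_derivative 0) (at t)"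
  proof -
    define v where "v t = (if t < 1 then y - x else x - y)" for t :: real
    have "(shuttle x y has_vector_derivative v t) (at t)" if "t \<noteq> 1" for t
      using that shuttle_derivative[of t x y] by (auto simp: v_def)
    moreover have "(v has_vector_derivative 0) (at t)" if "t \<noteq> 1" for t
    \<comment> \<open>The step function \<open>v\<close> coincides with the constant
      \<open>v t\<close> on the open half-line containing \<open>t\<close>.\<close>
    proof (rule has_vector_derivative_transform_within_open)
      show "((\<lambda>_. v t) has_vector_derivative 0) (at t)" by simp
      show "open (if t < 1 then {..<1} else {1<..} :: real set)"
        "t \<in> (if t < 1 then {..<1} else {1<..})"
        using that by auto
    qed (auto simp: v_def split: if_splits)
    ultimately show ?thesis by blast
  qed
  moreover have "\<exists>vp vm. right_velocity (shuttle x y) 1 vp \<and> left_velocity (shuttle x y) 1 vm \<and>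
      reflects (tangent_space ?F y) vp vm \<and> vp - vm \<noteq> 0"
  proof (intro exI conjI)
    show "(x - y) - (y - x) \<noteq> 0"
    proof
      assume "(x - y) - (y - x) = 0"
      then have "2 *\<^sub>R (x - y) = 0" by (simp add: scaleR_2 algebra_simps)
      then show False using \<open>x \<noteq> y\<close> by simp
    qed
    show "reflects (tangent_space ?F y) (x - y) (y - x)" using ry reflects_sym by blast
  qed (rule shuttle_velocity)+
  moreover have "\<exists>v0p vTm. right_velocity (shuttle x y) 0 v0p \<and> left_velocity (shuttle x y) 2 vTm \<and>
      (x \<in> interior C \<longrightarrow> v0p = vTm) \<and>
      (x \<in> ?F \<longrightarrow> (\<exists>v0m vTp. reflects (tangent_space ?F x) v0p v0m \<and>
        reflects (tangent_space ?F x) vTp vTm \<and>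
        (v0p = vTm \<or> v0m = vTm \<or> v0p = vTp \<or> v0m = vTp)))"
  proof -
    \<comment> \<open>The interior case is vacuous. At the seam the path leaves with
      \<open>y - x\<close> and arrives with \<open>x - y\<close>; these are mirror images at
      \<open>x\<close>, so the alternative \<open>v0m = vTm\<close> holds.\<close>
    have "x \<notin> interior C" using xF by (simp add: frontier_def)
    moreover have "reflects (tangent_space ?F x) (y - x) (x - y)" using rx reflects_sym by blast
    ultimately show ?thesis using shuttle_velocity(1,4) by blast
  qed
  ultimately show ?thesis
    unfolding nongliding_billiard_trajectory_def
    using piecewise_smooth_on_shuttle yF by (simp add: ends)
qed

theorem theorem1p15:
  fixes \<Delta> :: "(real ^ 'n) set"
  assumes "smooth_convex_body \<Delta>"
  shows "\<exists>T \<sigma>. periodic_billiard_trajectory \<Delta> T \<sigma> \<and> curve_length 0 T \<sigma> \<le> pi * diameter \<Delta>"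
proof -
  have body: "convex_body \<Delta>" using assms by (simp add: smooth_convex_body_def)
  then obtain x y where xy: "x \<in> \<Delta>" "y \<in> \<Delta>" "x \<noteq> y" "dist x y = diameter \<Delta>"
    "\<And>u v. u \<in> \<Delta> \<Longrightarrow> v \<in> \<Delta> \<Longrightarrow> dist u v \<le> dist x y"
    by (rule convex_body_diametral_pair) blast
  have traj: "nongliding_billiard_trajectory \<Delta> 2 (shuttle x y) {1}"
    using body xy by (intro shuttle_billiard_trajectory) (auto simp: convex_body_def compact_imp_closed)
  \<comment> \<open>Start, bounce and end cut the path into two segments, each of length
    \<open>dist x y\<close>.\<close>
  have ts: "sorted_list_of_set ({0, 2} \<union> {1::real}) = [0, 1, 2]"
    by (simp add: sorted_list_of_set_insert_remove)
  have "curve_length 0 2 (shuttle x y) = 2 * dist x y"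
    unfolding curve_length_nongliding[OF traj] ts
    by (simp add: shuttle_def dist_commute[of y x] dist_norm norm_minus_commute numeral_2_eq_2)
  also have "\<dots> \<le> pi * diameter \<Delta>"
    using xy(4) pi_ge_two by (metis mult_right_mono zero_le_dist)
  finally show ?thesis
    using traj by (auto simp: periodic_billiard_trajectory_def)
qed

end
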